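(* Let $f(x) = \frac12 \langle A x, x\rangle - \langle b, x\rangle$ on the $n$-dimensional space $\mathbb{E}$, where $A : \mathbb{E} \to \mathbb{E}^*$ is self-adjoint positive definite and $b \in \mathbb{E}^*$. Let $B : \mathbb{E} \to \mathbb{E}^*$ be self-adjoint positive definite and let $\mu, L > 0$ satisfy $\mu B \preceq A \preceq L B$. Let $x_0 \in \mathbb{E}$ and $\phi_k \in [0,1]$ ($k \ge 0$) be arbitrary, and let the sequences $(x_k)$, $(G_k)$, $(u_k)$ be generated by $G_0 = L B$ and, for $k \ge 0$, $$x_{k+1} = x_k - G_k^{-1} \nabla f(x_k), \qquad u_k = x_{k+1} - x_k, \qquad G_{k+1} = \mathrm{Broyd}_{\phi_k}(A, G_k, u_k).$$ Then, for all $k \ge 1$, $$\lambda_f(x_k) \le \frac{1}{\prod_{i=0}^{k-1}\left(\phi_i \frac{\mu}{L} + 1 - \phi_i\right)^{1/2}} \left(\frac{n L}{\mu k}\right)^{k/2} \lambda_f(x_0).$$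
   Context: $\mathbb{E}$ is an $n$-dimensional real vector space with dual $\mathbb{E}^*$, and $\langle s, x\rangle$ is the value of $s \in \mathbb{E}^*$ at $x \in \mathbb{E}$. For self-adjoint linear operators $A, A_1 : \mathbb{E} \to \mathbb{E}^*$, $A \preceq A_1$ means $\langle (A_1 - A) x, x\rangle \ge 0$ for all $x \in \mathbb{E}$. For self-adjoint positive definite $A, G : \mathbb{E} \to \mathbb{E}^*$, $u \in \mathbb{E}\setminus\{0\}$ and $\phi \in \mathbb{R}$, define $$\mathrm{Broyd}_\phi(A,G,u) = \phi\left[ G - \frac{A u u^* G + G u u^* A}{\langle A u,u\rangle} + \left(\frac{\langle G u,u\rangle}{\langle A u,u\rangle} + 1\right)\frac{A u u^* A}{\langle A u,u\rangle}\right] + (1-\phi)\left[ G - \frac{G u u^* G}{\langle G u,u\rangle} + \frac{A u u^* A}{\langle A u,u\rangle}\right],$$ where $A u u^* G$ denotes the operator $h \mapsto \langle G u, h\rangle A u$, and similarly for the other products; and $\mathrm{Broyd}_\phi(A,G,0) = G$. For the quadratic function $f$ above, $\lambda_f(x) = \langle \nabla f(x), A^{-1} \nabla f(x)\rangle^{1/2}$, where $\nabla f(x) = A x - b \in \mathbb{E}^*$. *)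

theory Defs
  imports "HOL-Analysis.Analysis"
begin

text \<open>
  The primal space is an arbitrary Euclidean space type; its inner product is never used in the
  definitions. The dual space is the type of (bounded) linear functionals, and the pairing
  \<open>\<langle>s, x\<rangle>\<close> is the application \<open>s x\<close>. In finite dimension every linear map is bounded, so the bounded
  linear function type contains all linear functionals and all linear operators from the space to
  its dual.
\<close>

type_synonym 'a dual = "'a \<Rightarrow>\<^sub>L real"

type_synonym 'a op = "'a \<Rightarrow>\<^sub>L 'a dual"

definition self_adjoint :: "'a::euclidean_space op \<Rightarrow> bool" where
  "self_adjoint A \<longleftrightarrow> (\<forall>x y. A x y = A y x)"

definition pos_def :: "'a::euclidean_space op \<Rightarrow> bool" where
  "pos_def A \<longleftrightarrow> (\<forall>x. x \<noteq> 0 \<longrightarrow> A x x > 0)"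

definition op_le :: "'a::euclidean_space op \<Rightarrow> 'a op \<Rightarrow> bool" (infix "\<preceq>" 50) where
  "A \<preceq> A1 \<longleftrightarrow> (\<forall>x. (A1 - A) x x \<ge> 0)"

definition op_inv :: "'a::euclidean_space op \<Rightarrow> 'a dual \<Rightarrow> 'a" where
  "op_inv A = inv (blinfun_apply A)"

text \<open>The operator \<open>s t\<^sup>*\<close>, that is \<open>h \<mapsto> \<langle>t, h\<rangle> s\<close>, for functionals \<open>s\<close> and \<open>t\<close>.\<close>

definition dyad :: "'a::euclidean_space dual \<Rightarrow> 'a dual \<Rightarrow> 'a op" where
  "dyad s t = blinfun_scaleR_left s o\<^sub>L t"

lemma dyad_apply [simp]: "dyad s t h = t h *\<^sub>R s"
  by (simp add: dyad_def)

text \<open>For self-adjoint \<open>A\<close> and \<open>G\<close>, the product \<open>A u u\<^sup>* G\<close> is \<open>dyad (A u) (G u)\<close>.\<close>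

definition Broyd :: "real \<Rightarrow> 'a::euclidean_space op \<Rightarrow> 'a op \<Rightarrow> 'a \<Rightarrow> 'a op" where
  "Broyd \<phi> A G u =
    (if u = 0 then G else
       \<phi> *\<^sub>R (G - (1 / A u u) *\<^sub>R (dyad (A u) (G u) + dyad (G u) (A u))
                + ((G u u / A u u + 1) / A u u) *\<^sub>R dyad (A u) (A u))
     + (1 - \<phi>) *\<^sub>R (G - (1 / G u u) *\<^sub>R dyad (G u) (G u) + (1 / A u u) *\<^sub>R dyad (A u) (A u)))"

definition quad_fun :: "'a::euclidean_space op \<Rightarrow> 'a dual \<Rightarrow> 'a \<Rightarrow> real" where
  "quad_fun A b x = (1/2) * A x x - b x"

definition grad :: "('a::euclidean_space \<Rightarrow> real) \<Rightarrow> 'a \<Rightarrow> 'a dual" where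
  "grad f x = Blinfun (frechet_derivative f (at x))"

text \<open>The local norm of the gradient of \<open>f\<close> with respect to the (constant) Hessian \<open>A\<close>.\<close>

definition local_grad_norm :: "'a::euclidean_space op \<Rightarrow> ('a \<Rightarrow> real) \<Rightarrow> 'a \<Rightarrow> real" where
  "local_grad_norm A f x = sqrt (grad f x (op_inv A (grad f x)))"

lemma quad_fun_has_derivative:
  assumes "self_adjoint A"
  shows "(quad_fun A b has_derivative blinfun_apply (A x - b)) (at x)"
proof -
  have "((\<lambda>x. (1/2) * A x x - b x) has_derivative
      (\<lambda>h. (1/2) * (A x h + A h x) - b h)) (at x)"
    by (auto intro!: derivative_eq_intros simp: blinfun.bilinear_simps)
  moreover have "(\<lambda>h. (1/2) * (A x h + A h x) - b h) = blinfun_apply (A x - b)"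
    using assms by (auto simp: self_adjoint_def fun_eq_iff blinfun.bilinear_simps)
  ultimately show ?thesis
    by (simp add: quad_fun_def [abs_def])
qed

lemma grad_quad_fun:
  assumes "self_adjoint A"
  shows "grad (quad_fun A b) x = A x - b"
  using frechet_derivative_at [OF quad_fun_has_derivative [OF assms, of b x]]
  by (metis blinfun_apply_inverse grad_def)

lemma pos_def_bij:
  assumes "pos_def A"
  shows "bij (blinfun_apply A)"
proof (rule bijI)
  show inj: "inj (blinfun_apply A)"
  proof (rule injI)
    fix x y assume "A x = A y"
    then have "A (x - y) (x - y) = 0"
      by (simp add: blinfun.diff_right)
    then show "x = y"
      using assms unfolding pos_def_def by (metis eq_iff_diff_eq_0 less_irrefl)
  qed
  define r where "r s = (\<Sum>i\<in>Basis. s i *\<^sub>R i)" for s :: "'a dual"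
  have r: "s = t" if "r s = r t" for s t
  proof (rule blinfun_euclidean_eqI)
    fix i :: 'a assume i: "i \<in> Basis"
    have "r u \<bullet> i = u i" for u
      using i by (simp add: r_def)
    then show "s i = t i"
      using that by (metis (no_types))
  qed
  have "linear (\<lambda>x. r (A x))"
    by (rule linearI)
      (simp_all add: r_def blinfun.bilinear_simps scaleR_add_left sum.distrib scaleR_sum_right)
  moreover have "inj (\<lambda>x. r (A x))"
    using inj r by (auto simp: inj_def)
  ultimately have surj: "surj (\<lambda>x. r (A x))"
    by (simp add: linear_injective_imp_surjective)
  have "\<exists>x. s = A x" for s
  proof -
    obtain x where "r s = r (A x)"
      using surjD [OF surj, of "r s"] by auto
    then show ?thesis
      using r by blast
  qed
  then show "surj (blinfun_apply A)"
    by (auto simp: surj_def)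
qed

end

theory Submission
  imports Defs
begin

text \<open>
  The idea is to control the trace of \<open>A\<^sup>-\<^sup>1 G\<^sub>i\<close> along the iteration. Put \<open>\<eta> = L / \<mu>\<close>.

  Measured in the inner product given by \<open>A\<close>, the operator \<open>A\<close> is the identity. Both the DFP and the
  BFGS update keep \<open>G\<close> between \<open>A\<close> and \<open>\<eta> A\<close> (Broyd_ge and Broyd_le): each of them replaces the
  quadratic form \<open>G\<close> by its value at a translate of the argument along \<open>u\<close> and then corrects the value
  in the direction \<open>u\<close> to that of \<open>A\<close>.

  Let \<open>w = A\<^sup>-\<^sup>1 G u\<close>. A quasi-Newton step turns the gradient \<open>- A w\<close> into \<open>A (u - w)\<close>, so the squared
  local norm changes from \<open>\<langle>A w, w\<rangle>\<close> to \<open>\<langle>A (w - u), w - u\<rangle>\<close>; this is at most a factor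
  \<open>\<nu> = \<langle>A (w - u), w - u\<rangle> / \<langle>G u, u\<rangle>\<close> (step_contraction). On the other hand the same \<open>\<nu>\<close> measures
  how much the update improves \<open>G\<close>: the trace drops by at least \<open>(\<phi> / \<eta> + 1 - \<phi>) \<nu>\<close>
  (trace_decrease). The trace is nonnegative and starts at no more than \<open>n \<eta>\<close>, hence the weighted factors
  \<open>(\<phi>\<^sub>i / \<eta> + 1 - \<phi>\<^sub>i) \<nu>\<^sub>i\<close> have sum at most \<open>n \<eta>\<close>, and by the inequality between the arithmetic and
  the geometric mean the product of the first \<open>k\<close> of them is at most \<open>(n \<eta> / k)\<^sup>k\<close>. Dividing by the
  weights and taking square roots gives the rate.
\<close>

section \<open>Quadratic forms\<close>

lemma op_leD:
  fixes A G :: "'a::euclidean_space op"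
  shows "A \<preceq> G \<Longrightarrow> A x x \<le> G x x"
  by (auto simp: op_le_def blinfun.diff_left)

lemma op_leI:
  fixes A G :: "'a::euclidean_space op"
  shows "(\<And>x. A x x \<le> G x x) \<Longrightarrow> A \<preceq> G"
  by (auto simp: op_le_def blinfun.diff_left)

lemma op_inv_apply:
  fixes A :: "'a::euclidean_space op"
  assumes "pos_def A"
  shows "A (op_inv A s) = s" "op_inv A (A y) = y"
  using pos_def_bij [OF assms]
  by (simp_all add: op_inv_def bij_is_surj surj_f_inv_f bij_is_inj)

lemma pos_def_mono: "pos_def A \<Longrightarrow> A \<preceq> G \<Longrightarrow> pos_def G"
  unfolding pos_def_def using op_leD less_le_trans by blast

lemma form_translate:
  fixes G :: "'a::euclidean_space op"
  assumes "self_adjoint G"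
  shows "G (h - t *\<^sub>R u) (h - t *\<^sub>R u) = G h h - 2 * t * G u h + t\<^sup>2 * G u u"
  using assms
  by (simp add: self_adjoint_def blinfun.bilinear_simps power2_eq_square algebra_simps)

text \<open>Along the line \<open>h + \<real> u\<close> the form \<open>G\<close> is a quadratic polynomial; completing the square gives
  its minimum.\<close>

lemma form_translate_min:
  fixes G :: "'a::euclidean_space op"
  assumes "self_adjoint G" "G u u > 0"
  shows "G h h - (G u h)\<^sup>2 / G u u \<le> G (h - t *\<^sub>R u) (h - t *\<^sub>R u)"
proof -
  have "G (h - t *\<^sub>R u) (h - t *\<^sub>R u) - (G h h - (G u h)\<^sup>2 / G u u)
      = (G u h - t * G u u)\<^sup>2 / G u u"
    using assms(2) unfolding form_translate [OF assms(1)]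
    by (simp add: field_simps power2_eq_square)
  also have "\<dots> \<ge> 0"
    using assms(2) by simp
  finally show ?thesis by simp
qed

lemma form_translate_min_attained:
  fixes G :: "'a::euclidean_space op"
  assumes "self_adjoint G" "G u u > 0"
  shows "G (h - (G u h / G u u) *\<^sub>R u) (h - (G u h / G u u) *\<^sub>R u) = G h h - (G u h)\<^sup>2 / G u u"
  using assms(2) unfolding form_translate [OF assms(1)]
  by (simp add: field_simps power2_eq_square)

lemma form_Cauchy_Schwarz:
  fixes G :: "'a::euclidean_space op"
  assumes "self_adjoint G" and nonneg: "\<And>x. G x x \<ge> 0"
  shows "(G u h)\<^sup>2 \<le> G u u * G h h"
proof (cases "G u u = 0")
  case True
  have "G u h = 0"
  proof (rule ccontr)
    assume "G u h \<noteq> 0"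
    \<comment> \<open>The form is affine along the line, so it becomes negative far out.\<close>
    then have "G (h - ((G h h + 1) / (2 * G u h)) *\<^sub>R u) (h - ((G h h + 1) / (2 * G u h)) *\<^sub>R u) = - 1"
      unfolding form_translate [OF assms(1)] using True by (simp add: field_simps)
    then show False
      using nonneg by (metis neg_0_le_iff_le not_one_le_zero)
  qed
  then show ?thesis using True by simp
next
  case False
  then have "G u u > 0"
    using nonneg [of u] by simp
  moreover have "G h h - (G u h)\<^sup>2 / G u u \<ge> 0"
    using nonneg form_translate_min_attained [OF assms(1) \<open>G u u > 0\<close>] by metis
  ultimately show ?thesis
    by (simp add: field_simps)
qed

section \<open>Trace with respect to a conjugate basis\<close>

text \<open>A basis that is orthonormal in the inner product \<open>A\<close>; the size is a parameter because the basis
  is built one vector at a time.\<close>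

definition conjugate_set :: "'a::euclidean_space op \<Rightarrow> nat \<Rightarrow> 'a set \<Rightarrow> bool" where
  "conjugate_set A m E \<longleftrightarrow>
    finite E \<and> card E = m \<and> (\<forall>v\<in>E. \<forall>w\<in>E. A v w = (if v = w then 1 else 0))"

text \<open>Sums \<open>\<Sum>v\<in>E. G v v\<close> over a conjugate basis are traces of \<open>A\<^sup>-\<^sup>1 G\<close>; writing them this way makes
  the monotonicity in \<open>G\<close> evident.\<close>

definition trace_on :: "'a::euclidean_space set \<Rightarrow> 'a op \<Rightarrow> real" where
  "trace_on E G = (\<Sum>v\<in>E. G v v)"

lemma conjugate_set_component:
  fixes A :: "'a::euclidean_space op"
  assumes "conjugate_set A m E" "w \<in> E"
  shows "(\<Sum>v\<in>E. c v * A v w) = c w"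
proof -
  have "(\<Sum>v\<in>E. c v * A v w) = (\<Sum>v\<in>E. if v = w then c v else 0)"
    using assms by (intro sum.cong) (auto simp: conjugate_set_def)
  then show ?thesis
    using assms by (simp add: conjugate_set_def)
qed

lemma conjugate_residual:
  fixes A :: "'a::euclidean_space op"
  assumes "conjugate_set A m E" "w \<in> E"
  shows "A (y - (\<Sum>v\<in>E. A y v *\<^sub>R v)) w = 0"
  using conjugate_set_component [OF assms, of "A y"]
  by (simp add: blinfun.bilinear_simps)

text \<open>Gram-Schmidt orthogonalisation in the inner product \<open>A\<close>.\<close>

lemma conjugate_set_exists:
  fixes A :: "'a::euclidean_space op"
  assumes A: "self_adjoint A" "pos_def A" and "m \<le> DIM('a)"
  shows "\<exists>E. conjugate_set A m E"
  using assms(3)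
proof (induction m)
  case 0
  show ?case by (rule exI [of _ "{}"]) (simp add: conjugate_set_def)
next
  case (Suc m)
  then obtain E where E: "conjugate_set A m E" by auto
  have "dim (span E) < DIM('a)"
    using E Suc.prems dim_le_card [of "span E" E] by (auto simp: conjugate_set_def)
  then obtain y where y: "y \<notin> span E"
    by (metis UNIV_eq_I dim_UNIV less_irrefl)
  define z where "z = y - (\<Sum>v\<in>E. A y v *\<^sub>R v)"
  have zE: "A z v = 0" if "v \<in> E" for v
    using conjugate_residual [OF E that] by (simp add: z_def)
  have "z \<noteq> 0"
  proof
    assume "z = 0"
    then have "y = (\<Sum>v\<in>E. A y v *\<^sub>R v)" by (simp add: z_def)
    also have "\<dots> \<in> span E" by (intro span_sum span_scale span_base)
    finally show False using y by simp
  qed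
  then have pos: "A z z > 0"
    using A by (simp add: pos_def_def)
  define e where "e = (1 / sqrt (A z z)) *\<^sub>R z"
  have ee: "A e e = 1"
    using pos by (simp add: e_def blinfun.bilinear_simps field_simps)
  have eE: "A e v = 0" "A v e = 0" if "v \<in> E" for v
    using A zE that by (auto simp: e_def blinfun.bilinear_simps self_adjoint_def)
  have "e \<notin> E"
    using ee eE by fastforce
  then have "conjugate_set A (Suc m) (insert e E)"
    using E ee eE by (auto simp: conjugate_set_def)
  then show ?case by blast
qed

lemma conjugate_basis_expansion:
  fixes A :: "'a::euclidean_space op"
  assumes A: "pos_def A" and E: "conjugate_set A (DIM('a)) E"
  shows "y = (\<Sum>v\<in>E. A y v *\<^sub>R v)"
proof -
  have fin: "finite E" and card: "card E = DIM('a)"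
    using E by (auto simp: conjugate_set_def)
  have "independent E"
  proof (rule independent_if_scalars_zero [OF fin])
    fix c w assume "(\<Sum>v\<in>E. c v *\<^sub>R v) = 0" "w \<in> E"
    then have "0 = A (\<Sum>v\<in>E. c v *\<^sub>R v) w" by simp
    also have "\<dots> = c w"
      using conjugate_set_component [OF E \<open>w \<in> E\<close>] by (simp add: blinfun.bilinear_simps)
    finally show "c w = 0" by simp
  qed
  then have spanE: "z \<in> span E" for z
    using card_ge_dim_independent [of E UNIV] card by auto
  define z where "z = y - (\<Sum>v\<in>E. A y v *\<^sub>R v)"
  have "A z x = 0" for x
    using spanE [of x]
  proof (induction rule: span_induct)
    case base
    show ?case by (auto simp: subspace_def blinfun.bilinear_simps)
  next
    case (step v)
    then show ?case
      using conjugate_residual [OF E] by (simp add: z_def)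
  qed
  then have "z = 0"
    using A by (metis less_irrefl pos_def_def)
  then show ?thesis by (simp add: z_def)
qed

lemma trace_on_linear:
  "trace_on E (G + H) = trace_on E G + trace_on E H"
  "trace_on E (G - H) = trace_on E G - trace_on E H"
  "trace_on E (c *\<^sub>R G) = c * trace_on E G"
  by (simp_all add: trace_on_def blinfun.bilinear_simps sum.distrib sum_subtractf sum_distrib_left)

lemma trace_on_mono: "G \<preceq> H \<Longrightarrow> trace_on E G \<le> trace_on E H"
  unfolding trace_on_def by (intro sum_mono op_leD)

lemma trace_on_self: "conjugate_set A m E \<Longrightarrow> trace_on E A = m"
  by (simp add: trace_on_def conjugate_set_def)

lemma trace_on_dyad:
  fixes A :: "'a::euclidean_space op"
  assumes "pos_def A" "conjugate_set A (DIM('a)) E"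
  shows "trace_on E (dyad (A y) t) = t y" "trace_on E (dyad t (A y)) = t y"
proof -
  have "t y = t (\<Sum>v\<in>E. A y v *\<^sub>R v)"
    using conjugate_basis_expansion [OF assms, of y] by simp
  also have "\<dots> = (\<Sum>v\<in>E. A y v * t v)"
    by (simp add: blinfun.bilinear_simps)
  finally show "trace_on E (dyad (A y) t) = t y" "trace_on E (dyad t (A y)) = t y"
    by (simp_all add: trace_on_def blinfun.bilinear_simps mult.commute)
qed

section \<open>The Broyden update\<close>

lemma self_adjoint_Broyd:
  assumes "self_adjoint A" "self_adjoint G"
  shows "self_adjoint (Broyd \<phi> A G u)"
  using assms
  by (simp add: self_adjoint_def Broyd_def blinfun.bilinear_simps algebra_simps)

text \<open>Both updates replace \<open>G\<close> by a translate of its argument along \<open>u\<close> before restoring the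
  curvature of \<open>A\<close> in the direction \<open>u\<close>: DFP uses the projection that is orthogonal for \<open>A\<close>, BFGS the
  one that is orthogonal for \<open>G\<close>.\<close>

lemma Broyd_form:
  fixes A G :: "'a::euclidean_space op"
  assumes "self_adjoint G" "u \<noteq> 0" "A u u > 0" "G u u > 0"
  defines "p \<equiv> \<lambda>h. h - (A u h / A u u) *\<^sub>R u"
  shows "Broyd \<phi> A G u h h =
    \<phi> * G (p h) (p h) + (1 - \<phi>) * (G h h - (G u h)\<^sup>2 / G u u) + (A u h)\<^sup>2 / A u u"
proof -
  have form: "G (p h) (p h) = G h h - 2 * (A u h / A u u) * G u h + (A u h / A u u)\<^sup>2 * G u u"
    unfolding p_def by (rule form_translate [OF assms(1)])
  show ?thesis
    unfolding form using assms(2-4)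
    by (simp add: Broyd_def blinfun.bilinear_simps field_simps power2_eq_square)
qed

text \<open>The lower bound \<open>A \<preceq> G\<close> passes to both translated forms, since the translate of \<open>h\<close> along \<open>u\<close>
  with the smallest value of \<open>A\<close> is the \<open>A\<close>-orthogonal one.\<close>

lemma Broyd_ge:
  fixes A G :: "'a::euclidean_space op"
  assumes A: "self_adjoint A" "pos_def A" and G: "self_adjoint G" and AG: "A \<preceq> G"
    and \<phi>: "\<phi> \<in> {0..1}"
  shows "A \<preceq> Broyd \<phi> A G u"
proof (cases "u = 0")
  case True
  then show ?thesis using AG by (simp add: Broyd_def)
next
  case False
  have pos: "A u u > 0" "G u u > 0"
    using A(2) pos_def_mono [OF A(2) AG] False by (auto simp: pos_def_def)
  show ?thesis
  proof (rule op_leI)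
    fix h
    let ?m = "A h h - (A u h)\<^sup>2 / A u u"
    let ?p = "h - (A u h / A u u) *\<^sub>R u" and ?q = "h - (G u h / G u u) *\<^sub>R u"
    have 1: "?m \<le> G ?p ?p"
      using form_translate_min [OF A(1) pos(1)] op_leD [OF AG] by (rule order_trans)
    have "?m \<le> G ?q ?q"
      using form_translate_min [OF A(1) pos(1)] op_leD [OF AG] by (rule order_trans)
    then have 2: "?m \<le> G h h - (G u h)\<^sup>2 / G u u"
      by (simp add: form_translate_min_attained [OF G pos(2)])
    have "?m = \<phi> * ?m + (1 - \<phi>) * ?m"
      by (simp add: left_diff_distrib)
    also have "\<dots> \<le> \<phi> * G ?p ?p + (1 - \<phi>) * (G h h - (G u h)\<^sup>2 / G u u)"
      using 1 2 \<phi> by (intro add_mono mult_left_mono) auto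
    finally show "A h h \<le> Broyd \<phi> A G u h h"
      using Broyd_form [OF G False pos, of \<phi> h] by simp
  qed
qed

text \<open>The form of BFGS is the minimum of \<open>G\<close> over translates along \<open>u\<close> and hence lies below that of
  DFP, so the DFP case is decisive; there \<open>G \<preceq> \<eta> A\<close> is applied to the \<open>A\<close>-orthogonal projection.\<close>

lemma Broyd_le:
  fixes A G :: "'a::euclidean_space op"
  assumes A: "self_adjoint A" "pos_def A" and G: "self_adjoint G" "pos_def G"
    and G\<eta>: "G \<preceq> \<eta> *\<^sub>R A" and \<eta>: "\<eta> \<ge> 1" and \<phi>: "\<phi> \<in> {0..1}"
  shows "Broyd \<phi> A G u \<preceq> \<eta> *\<^sub>R A"
proof (cases "u = 0")
  case True
  then show ?thesis using G\<eta> by (simp add: Broyd_def)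
next
  case False
  have pos: "A u u > 0" "G u u > 0"
    using A(2) G(2) False by (auto simp: pos_def_def)
  show ?thesis
  proof (rule op_leI)
    fix h
    let ?p = "h - (A u h / A u u) *\<^sub>R u"
    have "\<phi> * G ?p ?p + (1 - \<phi>) * (G h h - (G u h)\<^sup>2 / G u u) \<le> G ?p ?p"
      using form_translate_min [OF G(1) pos(2)] \<phi> by (intro convex_bound_le) auto
    also have "\<dots> \<le> \<eta> * A ?p ?p"
      using op_leD [OF G\<eta>, of ?p] by (simp add: blinfun.scaleR_left)
    also have "\<dots> = \<eta> * A h h - \<eta> * ((A u h)\<^sup>2 / A u u)"
      by (simp add: form_translate_min_attained [OF A(1) pos(1)] right_diff_distrib)
    also have "\<dots> \<le> \<eta> * A h h - 1 * ((A u h)\<^sup>2 / A u u)"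
      using \<eta> pos by (intro diff_left_mono mult_right_mono) auto
    finally show "Broyd \<phi> A G u h h \<le> (\<eta> *\<^sub>R A) h h"
      using Broyd_form [OF G(1) False pos, of \<phi> h] by (simp add: blinfun.scaleR_left)
  qed
qed

lemma trace_Broyd:
  fixes A G :: "'a::euclidean_space op"
  assumes A: "pos_def A" and E: "conjugate_set A (DIM('a)) E"
    and w: "A w = G u" and u: "u \<noteq> 0"
  shows "trace_on E G - trace_on E (Broyd \<phi> A G u)
    = \<phi> * (G u u / A u u - 1) + (1 - \<phi>) * (A w w / G u u - 1)"
proof -
  have "A u u > 0"
    using A u by (simp add: pos_def_def)
  moreover have "trace_on E (dyad (A u) (G u)) = G u u" "trace_on E (dyad (G u) (A u)) = G u u"
    "trace_on E (dyad (A u) (A u)) = A u u" "trace_on E (dyad (G u) (G u)) = A w w"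
    using trace_on_dyad [OF A E] w by metis+
  ultimately show ?thesis
    using u by (simp add: Broyd_def trace_on_linear field_simps power2_eq_square)
qed

section \<open>Progress of a quasi-Newton step\<close>

text \<open>The vector \<open>w - u\<close> represents \<open>(G - A) u\<close> in the inner product \<open>A\<close>, so its norm is controlled
  by the form \<open>G - A\<close>, whose values lie between \<open>0\<close> and those of \<open>\<eta> A\<close>.\<close>

lemma residual_le:
  fixes A G :: "'a::euclidean_space op"
  assumes A: "self_adjoint A" "pos_def A" and G: "self_adjoint G"
    and AG: "A \<preceq> G" and G\<eta>: "G \<preceq> \<eta> *\<^sub>R A" and w: "A w = G u"
  shows "A (w - u) (w - u) \<le> \<eta> * (G u u - A u u)"
proof (cases "w = u")
  case True
  then show ?thesis using w by simp
next
  case False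
  define d where "d = w - u"
  have d: "A d d > 0"
    using A False by (simp add: d_def pos_def_def)
  have Gd: "(G - A) u d = A d d"
    using w by (simp add: d_def blinfun.bilinear_simps)
  have "self_adjoint (G - A)"
    using A G by (simp add: self_adjoint_def blinfun.bilinear_simps)
  moreover have nonneg: "(G - A) x x \<ge> 0" for x
    using AG by (simp add: op_le_def)
  ultimately have "(A d d)\<^sup>2 \<le> (G - A) u u * (G - A) d d"
    using form_Cauchy_Schwarz [of "G - A" u d] Gd by simp
  also have "\<dots> \<le> (G - A) u u * (\<eta> * A d d)"
    using op_leD [OF G\<eta>, of d] d nonneg
    by (intro mult_left_mono) (auto simp: blinfun.bilinear_simps)
  finally have "A d d * A d d \<le> (\<eta> * (G u u - A u u)) * A d d"
    by (simp add: power2_eq_square blinfun.bilinear_simps mult_ac)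
  then show ?thesis
    using d by (simp add: d_def)
qed

lemma step_contraction:
  fixes A G :: "'a::euclidean_space op"
  assumes A: "self_adjoint A" "pos_def A" and AG: "A \<preceq> G" and w: "A w = G u"
  shows "A (w - u) (w - u) \<le> A (w - u) (w - u) / G u u * A w w"
proof (cases "u = 0")
  case True
  then have "A w w = 0" using w by simp
  then have "w = 0" using A by (metis less_irrefl pos_def_def)
  then show ?thesis using True by simp
next
  case False
  have nonneg: "A x x \<ge> 0" for x
    using A by (cases "x = 0") (auto simp: pos_def_def less_imp_le)
  have g: "G u u > 0"
    using pos_def_mono [OF A(2) AG] False by (simp add: pos_def_def)
  have "(G u u)\<^sup>2 = (A u w)\<^sup>2"
    using A w by (metis self_adjoint_def)
  also have "\<dots> \<le> A u u * A w w"
    using A nonneg by (intro form_Cauchy_Schwarz)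
  also have "\<dots> \<le> G u u * A w w"
    using op_leD [OF AG] nonneg by (intro mult_right_mono)
  finally have "G u u \<le> A w w"
    using g by (simp add: power2_eq_square)
  then have "A (w - u) (w - u) * G u u \<le> A (w - u) (w - u) * A w w"
    using nonneg by (intro mult_left_mono)
  then show ?thesis
    using g by (simp add: field_simps)
qed

text \<open>BFGS lowers the trace by \<open>\<langle>A w, w\<rangle> / \<langle>G u, u\<rangle> - 1\<close>, which is at least \<open>\<nu>\<close> because
  \<open>\<langle>A u, u\<rangle> \<le> \<langle>G u, u\<rangle>\<close>. DFP lowers it by \<open>\<langle>(G - A) u, u\<rangle> / \<langle>A u, u\<rangle>\<close>, and comparing this with \<open>\<nu>\<close>
  costs the condition number \<open>\<eta>\<close>.\<close>

lemma trace_decrease: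
  fixes A G :: "'a::euclidean_space op"
  assumes A: "self_adjoint A" "pos_def A" and G: "self_adjoint G"
    and AG: "A \<preceq> G" and G\<eta>: "G \<preceq> \<eta> *\<^sub>R A" and \<eta>: "\<eta> > 0" and \<phi>: "\<phi> \<in> {0..1}"
    and E: "conjugate_set A (DIM('a)) E" and w: "A w = G u"
  shows "(\<phi> / \<eta> + 1 - \<phi>) * (A (w - u) (w - u) / G u u)
    \<le> trace_on E G - trace_on E (Broyd \<phi> A G u)"
proof (cases "u = 0")
  case True
  then show ?thesis by (simp add: Broyd_def)
next
  case False
  let ?r = "A (w - u) (w - u)"
  have a: "A u u > 0" and g: "G u u > 0"
    using A(2) pos_def_mono [OF A(2) AG] False by (auto simp: pos_def_def)
  have ag: "A u u \<le> G u u"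
    using AG by (rule op_leD)
  have "?r / G u u / \<eta> \<le> (G u u - A u u) / G u u"
    using residual_le [OF A G AG G\<eta> w] g \<eta> by (simp add: field_simps)
  also have "\<dots> \<le> (G u u - A u u) / A u u"
    using ag a by (intro divide_left_mono) auto
  finally have DFP: "?r / G u u / \<eta> \<le> G u u / A u u - 1"
    using a by (simp add: diff_divide_distrib)
  have auw: "A u w = G u u"
    using A w by (metis self_adjoint_def)
  have "?r = A w w - 2 * G u u + A u u"
    using auw w by (simp add: blinfun.bilinear_simps)
  then have BFGS: "?r / G u u \<le> A w w / G u u - 1"
    using ag g by (simp add: field_simps)
  have "(\<phi> / \<eta> + 1 - \<phi>) * (?r / G u u) = \<phi> * (?r / G u u / \<eta>) + (1 - \<phi>) * (?r / G u u)"
    by (simp add: add_divide_distrib diff_divide_distrib algebra_simps)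
  also have "\<dots> \<le> \<phi> * (G u u / A u u - 1) + (1 - \<phi>) * (A w w / G u u - 1)"
    using DFP BFGS \<phi> by (intro add_mono mult_left_mono) auto
  finally show ?thesis
    by (simp add: trace_Broyd [OF A(2) E w False])
qed

section \<open>From summable decrease to a superlinear rate\<close>

lemma prod_le_mean_power:
  fixes y :: "nat \<Rightarrow> real"
  assumes "k \<ge> 1" "\<And>i. y i \<ge> 0" "(\<Sum>i<k. y i) \<le> S"
  shows "(\<Prod>i<k. y i) \<le> (S / k) ^ k"
proof -
  have "(\<Prod>i<k. y i) powr (1 / k) \<le> (\<Sum>i<k. y i) / k"
    using arith_geom_mean [of "{..<k}" y] assms by (simp add: sum_divide_distrib lessThan_empty_iff)
  also have "\<dots> \<le> S / k"
    using assms by (simp add: divide_right_mono)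
  finally have "((\<Prod>i<k. y i) powr (1 / k)) ^ k \<le> (S / k) ^ k"
    by (intro power_mono) auto
  moreover have "((\<Prod>i<k. y i) powr (1 / k)) ^ k = (\<Prod>i<k. y i)"
    using assms by (simp add: powr_realpow' [symmetric] powr_powr prod_nonneg)
  ultimately show ?thesis by simp
qed

text \<open>Nonnegative factors, \<open>k\<close> in number, whose sum is at most \<open>S\<close> have a product of at most \<open>(S / k)\<^sup>k\<close>, which
  decays faster than any geometric sequence in \<open>k\<close>.\<close>

lemma weighted_contraction_bound:
  fixes r \<nu> p :: "nat \<Rightarrow> real"
  assumes "k \<ge> 1" and p: "\<And>i. p i > 0" and \<nu>: "\<And>i. \<nu> i \<ge> 0" and r0: "r 0 \<ge> 0"
    and step: "\<And>i. r (Suc i) \<le> \<nu> i * r i" and S: "(\<Sum>i<k. p i * \<nu> i) \<le> S"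
  shows "r k \<le> 1 / (\<Prod>i<k. p i) * (S / k) ^ k * r 0"
proof -
  have "r k \<le> (\<Prod>i<k. \<nu> i) * r 0"
  proof (induction k)
    case (Suc m)
    have "r (Suc m) \<le> \<nu> m * r m"
      by (rule step)
    also have "\<dots> \<le> \<nu> m * ((\<Prod>i<m. \<nu> i) * r 0)"
      using Suc.IH \<nu> by (rule mult_left_mono)
    finally show ?case
      by (simp add: mult_ac)
  qed simp
  moreover have "(\<Prod>i<k. p i) * (\<Prod>i<k. \<nu> i) \<le> (S / k) ^ k"
    using prod_le_mean_power [OF assms(1) _ S] p \<nu> by (simp add: prod.distrib less_imp_le)
  then have "(\<Prod>i<k. \<nu> i) \<le> (S / k) ^ k / (\<Prod>i<k. p i)"
    using p by (subst pos_le_divide_eq) (simp_all add: prod_pos mult.commute)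
  then have "(\<Prod>i<k. \<nu> i) \<le> 1 / (\<Prod>i<k. p i) * (S / k) ^ k"
    by simp
  ultimately show ?thesis
    using r0 by (meson mult_right_mono order_trans)
qed

theorem theorem3p2:
  fixes A B :: "'a::euclidean_space op"
    and b :: "'a dual"
    and f :: "'a \<Rightarrow> real"
    and \<mu> L :: real
    and \<phi> :: "nat \<Rightarrow> real"
    and x u :: "nat \<Rightarrow> 'a"
    and G :: "nat \<Rightarrow> 'a op"
    and n k :: nat
  assumes n: "n = DIM('a)"
    and A: "self_adjoint A" "pos_def A"
    and B: "self_adjoint B" "pos_def B"
    and f: "f = quad_fun A b"
    and \<mu>: "\<mu> > 0" and L: "L > 0"
    and bounds: "\<mu> *\<^sub>R B \<preceq> A" "A \<preceq> L *\<^sub>R B"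
    and \<phi>: "\<And>i. \<phi> i \<in> {0..1}"
    and G_0: "G 0 = L *\<^sub>R B"
    and x_Suc: "\<And>i. x (Suc i) = x i - op_inv (G i) (grad f (x i))"
    and u: "\<And>i. u i = x (Suc i) - x i"
    and G_Suc: "\<And>i. G (Suc i) = Broyd (\<phi> i) A (G i) (u i)"
    and k: "k \<ge> 1"
  shows "local_grad_norm A f (x k)
    \<le> 1 / (\<Prod>i<k. sqrt (\<phi> i * (\<mu> / L) + 1 - \<phi> i))
      * (n * L / (\<mu> * k)) powr (k / 2) * local_grad_norm A f (x 0)"
proof -
  define \<eta> where "\<eta> = L / \<mu>"
  have B\<eta>: "G 0 \<preceq> \<eta> *\<^sub>R A"
  proof (rule op_leI)
    fix y
    have "\<mu> * B y y \<le> A y y"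
      using op_leD [OF bounds(1), of y] by (simp add: blinfun.scaleR_left)
    then show "G 0 y y \<le> (\<eta> *\<^sub>R A) y y"
      using \<mu> L by (simp add: G_0 \<eta>_def blinfun.scaleR_left field_simps)
  qed
  obtain e :: 'a where "e \<noteq> 0"
    using nonzero_Basis SOME_Basis by blast
  then have "A e e > 0"
    using A by (simp add: pos_def_def)
  moreover have "A e e \<le> \<eta> * A e e"
    using op_leD [OF bounds(2), of e] op_leD [OF B\<eta>, of e] by (simp add: G_0 blinfun.scaleR_left)
  ultimately have \<eta>1: "\<eta> \<ge> 1"
    by simp
  have inv: "self_adjoint (G i) \<and> A \<preceq> G i \<and> G i \<preceq> \<eta> *\<^sub>R A" for i
  proof (induction i)
    case 0
    have "self_adjoint (G 0)"
      using B by (simp add: G_0 self_adjoint_def blinfun.scaleR_left)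
    then show ?case
      using bounds(2) B\<eta> by (simp add: G_0)
  next
    case (Suc i)
    then have G: "self_adjoint (G i)" "A \<preceq> G i" "G i \<preceq> \<eta> *\<^sub>R A" "pos_def (G i)"
      using pos_def_mono [OF A(2)] by auto
    show ?case
      unfolding G_Suc
      using self_adjoint_Broyd [OF A(1) G(1)] Broyd_ge [OF A G(1,2) \<phi>]
        Broyd_le [OF A G(1,4,3) \<eta>1 \<phi>] by blast
  qed
  have grad: "grad f y = A y - b" for y
    using grad_quad_fun [OF A(1)] by (simp add: f)
  define w where "w i = op_inv A (G i (u i))" for i
  have w: "A (w i) = G i (u i)" for i
    using op_inv_apply(1) [OF A(2)] by (simp add: w_def)
  have "G i (u i) = - grad f (x i)" for i
    using op_inv_apply(1) [OF pos_def_mono [OF A(2)]] inv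
    by (simp add: u x_Suc blinfun.minus_right)
  then have grad_x: "grad f (x i) = A (- w i)" for i
    by (simp add: w blinfun.minus_right)
  have grad_Suc: "grad f (x (Suc i)) = A (u i - w i)" for i
    using grad_x [of i] by (simp add: grad u blinfun.bilinear_simps algebra_simps)
  have norm: "local_grad_norm A f y = sqrt (A z z)" if "grad f y = A z" for y z
    using that op_inv_apply(2) [OF A(2)] by (simp add: local_grad_norm_def)
  have A_nonneg: "A y y \<ge> 0" for y
    using A by (cases "y = 0") (auto simp: pos_def_def less_imp_le)
  define r where "r i = (local_grad_norm A f (x i))\<^sup>2" for i
  have r: "r i = A (w i) (w i)" for i
    using norm [OF grad_x] A_nonneg by (simp add: r_def blinfun.bilinear_simps)
  have r_Suc: "r (Suc i) = A (w i - u i) (w i - u i)" for i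
    using norm [OF grad_Suc] A_nonneg [of "u i - w i"]
    by (simp add: r_def blinfun.bilinear_simps)
  have norm_r: "local_grad_norm A f (x i) = sqrt (r i)" for i
    using norm [OF grad_x] A_nonneg by (simp add: r_def)
  obtain E where E: "conjugate_set A (DIM('a)) E"
    using conjugate_set_exists [OF A] by blast
  define \<nu> where "\<nu> i = A (w i - u i) (w i - u i) / G i (u i) (u i)" for i
  define p where "p i = \<phi> i * (\<mu> / L) + 1 - \<phi> i" for i
  have p_pos: "p i > 0" for i
  proof (cases "\<phi> i = 0")
    case False
    then have "\<phi> i * (\<mu> / L) > 0"
      using \<phi> [of i] \<mu> L by simp
    then show ?thesis
      using \<phi> [of i] by (simp add: p_def)
  qed (simp add: p_def)
  have "0 \<le> A y y \<and> A y y \<le> G i y y" for i y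
    using A_nonneg op_leD inv by blast
  then have \<nu>_nonneg: "\<nu> i \<ge> 0" for i
    unfolding \<nu>_def by (meson divide_nonneg_nonneg order_trans)
  have step: "r (Suc i) \<le> \<nu> i * r i" for i
    unfolding r_Suc r [of i] \<nu>_def using step_contraction [OF A _ w] inv by blast
  have dec: "p i * \<nu> i \<le> trace_on E (G i) - trace_on E (G (Suc i))" for i
    using trace_decrease [OF A _ _ _ _ \<phi> E w, of i \<eta>] inv \<eta>1
    by (simp add: p_def \<nu>_def G_Suc \<eta>_def)
  have "(\<Sum>i<k. p i * \<nu> i) \<le> (\<Sum>i<k. trace_on E (G i) - trace_on E (G (Suc i)))"
    using dec by (rule sum_mono)
  also have "\<dots> = trace_on E (G 0) - trace_on E (G k)"
    by (rule sum_lessThan_telescope')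
  also have "\<dots> \<le> \<eta> * n"
    using trace_on_mono [of "G 0" "\<eta> *\<^sub>R A" E] trace_on_mono [of A "G k" E] inv
      trace_on_self [OF E] by (simp add: trace_on_linear n)
  finally have "r k \<le> 1 / (\<Prod>i<k. p i) * (\<eta> * n / k) ^ k * r 0"
    using weighted_contraction_bound [where r = r and p = p and \<nu> = \<nu>]
      k p_pos \<nu>_nonneg step by (simp add: r_def)
  moreover have "\<eta> * n / k = n * L / (\<mu> * k)"
    by (simp add: \<eta>_def)
  ultimately have "r k \<le> 1 / (\<Prod>i<k. p i) * (n * L / (\<mu> * k)) ^ k * r 0"
    by metis
  then have "sqrt (r k) \<le> sqrt (1 / (\<Prod>i<k. p i) * (n * L / (\<mu> * k)) ^ k * r 0)"
    by (rule real_sqrt_le_mono)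
  also have "\<dots> = 1 / (\<Prod>i<k. sqrt (p i)) * sqrt ((n * L / (\<mu> * k)) ^ k) * sqrt (r 0)"
  proof -
    have "sqrt (\<Prod>i<m. p i) = (\<Prod>i<m. sqrt (p i))" for m
      by (induction m) (simp_all add: real_sqrt_mult)
    then show ?thesis
      by (simp only: real_sqrt_mult real_sqrt_divide real_sqrt_one)
  qed
  also have "sqrt ((n * L / (\<mu> * k)) ^ k) = (n * L / (\<mu> * k)) powr (k / 2)"
  proof -
    have "n * L / (\<mu> * k) > 0"
      using n k \<mu> L by simp
    then show ?thesis
      by (simp add: powr_half_sqrt [symmetric] powr_realpow [symmetric] powr_powr)
  qed
  finally show ?thesis
    unfolding norm_r p_def .
qed

end
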